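(* Let $k$ be an algebraically closed field of characteristic $0$ and let $n\ge 3$. Then $\mathcal E_n$ and $\mathcal E_n^*$ are subvarieties of $\Sigma_n$.
   Context: For $A,B\subseteq k$, $A\le_p B$ means that there is a polynomial $P\in k[X]$ with $A=P^{-1}(B)$; $A\equiv_p B$ means $A\le_p B$ and $B\le_p A$; $[A]$ is the $\equiv_p$-class of $A$. $\mathcal P_n$ is the set of $n$-element subsets of $k$, and $\Sigma_n=\{[A]\mid A\in\mathcal P_n\}$. Two elements of $\mathcal P_n$ are $\equiv_p$-equivalent if and only if one is the image of the other under a linear polynomial $cX+c'$ with $c\neq 0$. Variety structures: let $f_n=\prod_{j\ne j'}(X_j-X_{j'})$ and let $D(f_n)\subseteq k^n$ be the open set of points with pairwise distinct coordinates, an affine variety with ring of regular functions $k[X_1,\ldots,X_n]_{f_n}$. $\mathcal P_n$ is the affine variety obtained as the geometric quotient of $D(f_n)$ by the symmetric group $Sym_n$ permuting coordinates; its regular functions are the $Sym_n$-invariant regular functions on $D(f_n)$. $\Sigma_n$ is the affine variety obtained as the geometric quotient of $\mathcal P_n$ by the action $(P,A)\mapsto P(A)$ of the group of linear polynomials: it has the quotient topology (so a subset of $\Sigma_n$ is closed iff its preimage under $D(f_n)\to\Sigma_n$, $(a_1,\ldots,a_n)\mapsto[\{a_1,\ldots,a_n\}]$, is closed in $D(f_n)$), and its regular functions are the regular functions on $\mathcal P_n$ invariant under this action. A subvariety is a (possibly empty, possibly reducible) Zariski closed subset. Exceptional classes: for $B=\{b_1,\ldots,b_n\}\in\mathcal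 P_n$ and $\sigma\in Sym_n$, let $\pi_\sigma\subseteq k^n$ be the plane of solutions of the linear system $(b_{\sigma(j)}-b_{\sigma(2)})x_1+(b_{\sigma(1)}-b_{\sigma(j)})x_2+(b_{\sigma(2)}-b_{\sigma(1)})x_j=0$, $j\in\{3,\ldots,n\}$. The planes $\pi_\sigma$ are the characteristic planes of $B$; the set $\{\pi_\sigma\mid\sigma\in Sym_n\}$ depends only on $[B]$, and its cardinality is denoted $\chi(B)$. $B$ is an exceptional set, and $[B]$ an exceptional class, if $\chi(B)<n!$. A permutation $\tau$ of $B$ is a characteristic permutation of $B$ if the value $\frac{\tau(b)-\tau(b')}{b-b'}$ is the same for all pairs of distinct $b,b'\in B$; $G_B$ denotes the group of characteristic permutations of $B$. $\mathcal E_n$ is the set of exceptional classes of $\Sigma_n$, and $\mathcal E_n^*$ is the set of exceptional classes $[B]\in\Sigma_n$ such that $G_B$ has even order. *)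

theory Defs
  imports
    "HOL-Analysis.Analysis"
    "HOL-Library.Poly_Mapping"
    "HOL-Combinatorics.Permutations"
    "HOL-Computational_Algebra.Polynomial"
    "HOL-Algebra.Coset"
begin

definition poly_le :: "'a::field set \<Rightarrow> 'a set \<Rightarrow> bool"  (infix \<open>\<le>\<^sub>p\<close> 50) where
  "A \<le>\<^sub>p B \<longleftrightarrow> (\<exists>P::'a poly. A = poly P -` B)"

definition poly_equiv :: "('a::field set \<times> 'a set) set" where
  "poly_equiv = {(A, B). A \<le>\<^sub>p B \<and> B \<le>\<^sub>p A}"

lemma equiv_poly_equiv: "equiv UNIV (poly_equiv :: ('a::field set \<times> 'a set) set)"
proof -
  have r: "A \<le>\<^sub>p A" for A :: "'a set"
    unfolding poly_le_def by (rule exI[of _ "[:0, 1:]"]) auto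
  have t: "A \<le>\<^sub>p C" if AB: "A \<le>\<^sub>p B" and BC: "B \<le>\<^sub>p C" for A B C :: "'a set"
  proof -
    obtain P Q where P: "A = poly P -` B" and Q: "B = poly Q -` C"
      using AB BC unfolding poly_le_def by auto
    have "A = poly (pcompose Q P) -` C"
      unfolding P Q by (auto simp: poly_pcompose)
    then show ?thesis unfolding poly_le_def by blast
  qed
  show ?thesis
    by (rule equivI) (auto simp: poly_equiv_def refl_on_def sym_def trans_def intro: r t)
qed

definition poly_class :: "'a::field set \<Rightarrow> 'a set set" where
  "poly_class A = poly_equiv `` {A}"

definition n_subsets :: "nat \<Rightarrow> 'a set set" where
  "n_subsets n = {A. finite A \<and> card A = n}"

definition Sigma_classes :: "nat \<Rightarrow> 'a::field set set set" where
  "Sigma_classes n = poly_class ` n_subsets n"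

text \<open>The points of $k^n$ are the extensional functions on the index set $\{1,\ldots,n\}$.\<close>

definition affine_points :: "nat \<Rightarrow> (nat \<Rightarrow> 'a) set" where
  "affine_points n = ({1..n} \<rightarrow>\<^sub>E UNIV)"

text \<open>A multivariate polynomial is a finitely supported map from exponent vectors to
  coefficients, multiplication being the convolution product of \<^typ>\<open>('a, 'b) poly_mapping\<close>.\<close>

type_synonym 'a multi_poly = "(nat \<Rightarrow>\<^sub>0 nat) \<Rightarrow>\<^sub>0 'a"

definition multi_polys :: "nat \<Rightarrow> 'a::zero multi_poly set" where
  "multi_polys n = {p. \<forall>m\<in>Poly_Mapping.keys p. Poly_Mapping.keys m \<subseteq> {1..n}}"

definition multi_monom_eval :: "(nat \<Rightarrow> 'a::comm_semiring_1) \<Rightarrow> (nat \<Rightarrow>\<^sub>0 nat) \<Rightarrow> 'a" where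
  "multi_monom_eval a m = (\<Prod>i\<in>Poly_Mapping.keys m. a i ^ Poly_Mapping.lookup m i)"

definition multi_eval :: "'a::comm_semiring_1 multi_poly \<Rightarrow> (nat \<Rightarrow> 'a) \<Rightarrow> 'a" where
  "multi_eval p a = (\<Sum>m\<in>Poly_Mapping.keys p. Poly_Mapping.lookup p m * multi_monom_eval a m)"

lemma multi_monom_eval_superset:
  assumes "finite S" "Poly_Mapping.keys m \<subseteq> S"
  shows "multi_monom_eval a m = (\<Prod>i\<in>S. a i ^ Poly_Mapping.lookup m i)"
  unfolding multi_monom_eval_def
  by (rule prod.mono_neutral_left) (use assms in \<open>auto simp: in_keys_iff\<close>)

lemma multi_monom_eval_add:
  "multi_monom_eval a (m + m') = multi_monom_eval a m * multi_monom_eval a m'"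
proof -
  let ?S = "Poly_Mapping.keys m \<union> Poly_Mapping.keys m'"
  have "Poly_Mapping.keys (m + m') \<subseteq> ?S" by (rule keys_add)
  then show ?thesis
    by (simp add: multi_monom_eval_superset[of ?S] lookup_add power_add prod.distrib)
qed

lemma multi_eval_superset:
  assumes "finite S" "Poly_Mapping.keys p \<subseteq> S"
  shows "multi_eval p a = (\<Sum>m\<in>S. Poly_Mapping.lookup p m * multi_monom_eval a m)"
  unfolding multi_eval_def
  by (rule sum.mono_neutral_left) (use assms in \<open>auto simp: in_keys_iff\<close>)

lemma multi_eval_zero [simp]: "multi_eval 0 a = 0"
  by (simp add: multi_eval_def)

lemma multi_eval_one [simp]: "multi_eval 1 a = 1"
  by (simp add: multi_eval_def multi_monom_eval_def)

lemma multi_eval_add: "multi_eval (p + q) a = multi_eval p a + multi_eval q a"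
proof -
  let ?S = "Poly_Mapping.keys p \<union> Poly_Mapping.keys q"
  have "Poly_Mapping.keys (p + q) \<subseteq> ?S" by (rule keys_add)
  then show ?thesis
    by (simp add: multi_eval_superset[of ?S] lookup_add distrib_right sum.distrib)
qed

lemma multi_eval_sum: "multi_eval (\<Sum>i\<in>I. f i) a = (\<Sum>i\<in>I. multi_eval (f i) a)"
  by (induction I rule: infinite_finite_induct) (auto simp: multi_eval_add)

lemma multi_eval_single: "multi_eval (Poly_Mapping.single m c) a = c * multi_monom_eval a m"
  by (cases "c = 0") (auto simp: multi_eval_def)

lemma multi_poly_sum_monoms:
  "p = (\<Sum>m\<in>Poly_Mapping.keys p. Poly_Mapping.single m (Poly_Mapping.lookup p m))"
proof (rule poly_mapping_eqI)
  fix k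
  have "Poly_Mapping.lookup (\<Sum>m\<in>Poly_Mapping.keys p. Poly_Mapping.single m (Poly_Mapping.lookup p m)) k
      = (\<Sum>m\<in>Poly_Mapping.keys p. if k = m then Poly_Mapping.lookup p k else 0)"
    unfolding lookup_sum by (rule sum.cong) (auto simp: lookup_single when_def)
  also have "\<dots> = Poly_Mapping.lookup p k"
    by (auto simp: in_keys_iff)
  finally show "Poly_Mapping.lookup p k = Poly_Mapping.lookup (\<Sum>m\<in>Poly_Mapping.keys p. Poly_Mapping.single m (Poly_Mapping.lookup p m)) k" ..
qed

lemma multi_eval_mult: "multi_eval (p * q) a = multi_eval p a * multi_eval q a"
proof -
  have "p * q = (\<Sum>m\<in>Poly_Mapping.keys p. Poly_Mapping.single m (Poly_Mapping.lookup p m))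
      * (\<Sum>m\<in>Poly_Mapping.keys q. Poly_Mapping.single m (Poly_Mapping.lookup q m))"
    by (rule arg_cong2[where f = "(*)", OF multi_poly_sum_monoms multi_poly_sum_monoms])
  also have "\<dots> = (\<Sum>m\<in>Poly_Mapping.keys p. \<Sum>m'\<in>Poly_Mapping.keys q.
      Poly_Mapping.single (m + m') (Poly_Mapping.lookup p m * Poly_Mapping.lookup q m'))"
    by (simp add: sum_product mult_single)
  finally have "multi_eval (p * q) a = (\<Sum>m\<in>Poly_Mapping.keys p. \<Sum>m'\<in>Poly_Mapping.keys q.
      (Poly_Mapping.lookup p m * multi_monom_eval a m) * (Poly_Mapping.lookup q m' * multi_monom_eval a m'))"
    by (simp add: multi_eval_sum multi_eval_single multi_monom_eval_add mult_ac)
  then show ?thesis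
    by (simp add: multi_eval_def sum_product)
qed

lemma zero_in_multi_polys [simp]: "0 \<in> multi_polys n"
  and one_in_multi_polys [simp]: "1 \<in> multi_polys n"
  by (auto simp: multi_polys_def)

lemma mult_in_multi_polys:
  fixes p q :: "'a::semiring_0 multi_poly"
  assumes "p \<in> multi_polys n" "q \<in> multi_polys n"
  shows "p * q \<in> multi_polys n"
  unfolding multi_polys_def
proof (intro CollectI ballI)
  fix m assume "m \<in> Poly_Mapping.keys (p * q)"
  then obtain u v where uv: "u \<in> Poly_Mapping.keys p" "v \<in> Poly_Mapping.keys q" "m = u + v"
    using keys_mult[of p q] by auto
  then have "Poly_Mapping.keys m \<subseteq> Poly_Mapping.keys u \<union> Poly_Mapping.keys v" using keys_add[of u v] by simp
  also have "\<dots> \<subseteq> {1..n}" using uv assms unfolding multi_polys_def by blast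
  finally show "Poly_Mapping.keys m \<subseteq> {1..n}" .
qed

definition zero_locus :: "nat \<Rightarrow> 'a::comm_semiring_1 multi_poly set \<Rightarrow> (nat \<Rightarrow> 'a) set" where
  "zero_locus n F = {a \<in> affine_points n. \<forall>p\<in>F. multi_eval p a = 0}"

definition zariski :: "nat \<Rightarrow> (nat \<Rightarrow> 'a::field) topology" where
  "zariski n = topology (\<lambda>U. \<exists>F \<subseteq> multi_polys n. U = affine_points n - zero_locus n F)"

lemma istopology_zariski:
  "istopology (\<lambda>U. \<exists>F \<subseteq> (multi_polys n :: 'a::field multi_poly set).
     U = affine_points n - zero_locus n F)"
  unfolding istopology_def
proof (intro conjI allI impI)
  fix U V :: "(nat \<Rightarrow> 'a) set"
  assume "\<exists>F \<subseteq> multi_polys n. U = affine_points n - zero_locus n F"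
  then obtain F where F: "F \<subseteq> multi_polys n" "U = affine_points n - zero_locus n F" by blast
  assume "\<exists>F \<subseteq> multi_polys n. V = affine_points n - zero_locus n F"
  then obtain G where G: "G \<subseteq> multi_polys n" "V = affine_points n - zero_locus n G" by blast
  let ?H = "{p * q | p q. p \<in> F \<and> q \<in> G}"
  have "?H \<subseteq> multi_polys n"
    using F(1) G(1) by (blast intro: mult_in_multi_polys)
  moreover have "U \<inter> V = affine_points n - zero_locus n ?H"
    unfolding F(2) G(2) zero_locus_def
  proof (intro equalityI subsetI)
    fix a assume "a \<in> (affine_points n - {a \<in> affine_points n. \<forall>p\<in>F. multi_eval p a = 0})
      \<inter> (affine_points n - {a \<in> affine_points n. \<forall>p\<in>G. multi_eval p a = 0})"
    then obtain p q where "a \<in> affine_points n" and pq: "p \<in> F" "q \<in> G"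
        "multi_eval p a \<noteq> 0" "multi_eval q a \<noteq> 0"
      by blast
    moreover from pq have "multi_eval (p * q) a \<noteq> 0" "p * q \<in> ?H"
      by (auto simp: multi_eval_mult)
    ultimately show "a \<in> affine_points n - {a \<in> affine_points n. \<forall>p\<in>?H. multi_eval p a = 0}"
      by blast
  next
    fix a assume "a \<in> affine_points n - {a \<in> affine_points n. \<forall>p\<in>?H. multi_eval p a = 0}"
    then obtain p q where a: "a \<in> affine_points n" and pq: "p \<in> F" "q \<in> G"
        "multi_eval (p * q) a \<noteq> 0"
      by blast
    then have "multi_eval p a \<noteq> 0" "multi_eval q a \<noteq> 0"
      by (auto simp: multi_eval_mult)
    then show "a \<in> (affine_points n - {a \<in> affine_points n. \<forall>p\<in>F. multi_eval p a = 0})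
      \<inter> (affine_points n - {a \<in> affine_points n. \<forall>p\<in>G. multi_eval p a = 0})"
      using a pq by blast
  qed
  ultimately show "\<exists>F \<subseteq> multi_polys n. U \<inter> V = affine_points n - zero_locus n F" by blast
next
  fix \<K> :: "(nat \<Rightarrow> 'a) set set"
  assume "\<forall>U\<in>\<K>. \<exists>F \<subseteq> multi_polys n. U = affine_points n - zero_locus n F"
  then have "\<exists>F. \<forall>U\<in>\<K>. F U \<subseteq> multi_polys n \<and> U = affine_points n - zero_locus n (F U)"
    by (intro bchoice) blast
  then obtain F where F: "\<And>U. U \<in> \<K> \<Longrightarrow> F U \<subseteq> multi_polys n"
      "\<And>U. U \<in> \<K> \<Longrightarrow> U = affine_points n - zero_locus n (F U)"
    by blast
  have "(\<Union>U\<in>\<K>. U) = (\<Union>U\<in>\<K>. affine_points n - zero_locus n (F U))"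
    by (rule SUP_cong[OF refl]) (rule F(2))
  then have "\<Union>\<K> = (\<Union>U\<in>\<K>. affine_points n - zero_locus n (F U))"
    by (simp only: image_ident)
  also have "\<dots> = affine_points n - zero_locus n (\<Union>(F ` \<K>))"
    unfolding zero_locus_def by auto
  finally have "\<Union>\<K> = affine_points n - zero_locus n (\<Union>(F ` \<K>))" .
  moreover have "\<Union>(F ` \<K>) \<subseteq> multi_polys n"
    using F(1) by blast
  ultimately show "\<exists>F \<subseteq> multi_polys n. \<Union>\<K> = affine_points n - zero_locus n F" by blast
qed

lemma openin_zariski:
  "openin (zariski n) U \<longleftrightarrow> (\<exists>F \<subseteq> multi_polys n. U = affine_points n - zero_locus n F)"
  unfolding zariski_def topology_inverse'[OF istopology_zariski] ..

lemma openin_zariski_subset: "openin (zariski n) U \<Longrightarrow> U \<subseteq> affine_points n"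
  unfolding openin_zariski by (elim exE conjE) simp

lemma topspace_zariski [simp]:
  "topspace (zariski n :: (nat \<Rightarrow> 'a::field) topology) = affine_points n"
proof (rule antisym)
  show "topspace (zariski n :: (nat \<Rightarrow> 'a) topology) \<subseteq> affine_points n"
    by (rule openin_zariski_subset[OF openin_topspace])
  have "zero_locus n {1 :: 'a multi_poly} = {}"
    by (simp add: zero_locus_def)
  then have "affine_points n = affine_points n - zero_locus n {1 :: 'a multi_poly}"
    by simp
  moreover have "{1 :: 'a multi_poly} \<subseteq> multi_polys n"
    by simp
  ultimately have "openin (zariski n) (affine_points n :: (nat \<Rightarrow> 'a) set)"
    unfolding openin_zariski by (intro exI conjI)
  then show "affine_points n \<subseteq> topspace (zariski n :: (nat \<Rightarrow> 'a) topology)"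
    by (rule openin_subset)
qed

lemma closedin_zariski:
  "closedin (zariski n) Z \<longleftrightarrow> (\<exists>F \<subseteq> multi_polys n. Z = zero_locus n F)"
proof -
  have sub: "zero_locus n F \<subseteq> affine_points n" for F :: "'a multi_poly set"
    by (auto simp: zero_locus_def)
  show ?thesis
  proof
    assume "closedin (zariski n) Z"
    then obtain F where F: "Z \<subseteq> affine_points n" "F \<subseteq> multi_polys n"
        "affine_points n - Z = affine_points n - zero_locus n F"
      unfolding closedin_def openin_zariski topspace_zariski by blast
    then have "Z = zero_locus n F" using sub[of F] by blast
    then show "\<exists>F \<subseteq> multi_polys n. Z = zero_locus n F" using F(2) by blast
  next
    assume "\<exists>F \<subseteq> multi_polys n. Z = zero_locus n F"
    then show "closedin (zariski n) Z"
      unfolding closedin_def openin_zariski topspace_zariski using sub by blast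
  qed
qed

definition quotient_topology :: "'a topology \<Rightarrow> ('a \<Rightarrow> 'b) \<Rightarrow> 'b topology" where
  "quotient_topology X f =
     topology (\<lambda>U. U \<subseteq> f ` topspace X \<and> openin X {x \<in> topspace X. f x \<in> U})"

lemma openin_quotient_topology:
  "openin (quotient_topology X f) U \<longleftrightarrow>
     U \<subseteq> f ` topspace X \<and> openin X {x \<in> topspace X. f x \<in> U}"
proof -
  have "istopology (\<lambda>U. U \<subseteq> f ` topspace X \<and> openin X {x \<in> topspace X. f x \<in> U})"
    unfolding istopology_def
  proof (intro conjI allI impI)
    fix S T
    assume S: "S \<subseteq> f ` topspace X \<and> openin X {x \<in> topspace X. f x \<in> S}"
      and T: "T \<subseteq> f ` topspace X \<and> openin X {x \<in> topspace X. f x \<in> T}"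
    show "S \<inter> T \<subseteq> f ` topspace X" using S by blast
    have "{x \<in> topspace X. f x \<in> S \<inter> T}
        = {x \<in> topspace X. f x \<in> S} \<inter> {x \<in> topspace X. f x \<in> T}" by blast
    then show "openin X {x \<in> topspace X. f x \<in> S \<inter> T}"
      using S T by (simp add: openin_Int)
  next
    fix \<K>
    assume K: "\<forall>S\<in>\<K>. S \<subseteq> f ` topspace X \<and> openin X {x \<in> topspace X. f x \<in> S}"
    then show "\<Union>\<K> \<subseteq> f ` topspace X" by blast
    have "{x \<in> topspace X. f x \<in> \<Union>\<K>} = (\<Union>S\<in>\<K>. {x \<in> topspace X. f x \<in> S})" by blast
    moreover have "openin X (\<Union>S\<in>\<K>. {x \<in> topspace X. f x \<in> S})"
      using K by (intro openin_Union) auto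
    ultimately show "openin X {x \<in> topspace X. f x \<in> \<Union>\<K>}" by metis
  qed
  then show ?thesis
    unfolding quotient_topology_def by (simp add: topology_inverse')
qed

lemma topspace_quotient_topology [simp]:
  "topspace (quotient_topology X f) = f ` topspace X"
proof
  show "topspace (quotient_topology X f) \<subseteq> f ` topspace X"
    unfolding topspace_def openin_quotient_topology by blast
  have "{x \<in> topspace X. f x \<in> f ` topspace X} = topspace X" by blast
  then have "openin (quotient_topology X f) (f ` topspace X)"
    unfolding openin_quotient_topology by simp
  then show "f ` topspace X \<subseteq> topspace (quotient_topology X f)"
    by (rule openin_subset)
qed

lemma quotient_map_quotient_topology: "quotient_map X (quotient_topology X f) f"
  unfolding quotient_map_def by (simp add: openin_quotient_topology)

definition distinct_points :: "nat \<Rightarrow> (nat \<Rightarrow> 'a::field) set" where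
  "distinct_points n =
     {a \<in> affine_points n. (\<Prod>(j, j') \<in> {(j, j'). j \<in> {1..n} \<and> j' \<in> {1..n} \<and> j \<noteq> j'}. a j - a j') \<noteq> 0}"

lemma distinct_points_iff:
  "distinct_points n = {a \<in> affine_points n. inj_on a {1..n}}"
proof -
  let ?J = "{(j, j'). j \<in> {1..n} \<and> j' \<in> {1..n} \<and> j \<noteq> j'}"
  have fin: "finite ?J"
    by (rule finite_subset[of _ "{1..n} \<times> {1..n}"]) auto
  have "(\<Prod>(j, j')\<in>?J. a j - a j') = 0 \<longleftrightarrow> (\<exists>(j, j')\<in>?J. a j = a j')" for a :: "nat \<Rightarrow> 'a"
    by (simp only: prod_zero_iff[OF fin]) (simp add: case_prod_unfold)
  moreover have "(\<exists>(j, j')\<in>?J. a j = a j') \<longleftrightarrow> \<not> inj_on a {1..n}" for a :: "nat \<Rightarrow> 'a"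
    unfolding inj_on_def by blast
  ultimately have "(\<Prod>(j, j')\<in>?J. a j - a j') \<noteq> 0 \<longleftrightarrow> inj_on a {1..n}" for a :: "nat \<Rightarrow> 'a"
    by simp
  then show ?thesis unfolding distinct_points_def by (simp only:)
qed

definition distinct_topology :: "nat \<Rightarrow> (nat \<Rightarrow> 'a::field) topology" where
  "distinct_topology n = subtopology (zariski n) (distinct_points n)"

text \<open>The two geometric quotients carry the quotient topologies: the fibres of
  $a \mapsto \{a_1,\ldots,a_n\}$ are the orbits of the symmetric group on points with distinct
  coordinates, and (in characteristic $0$, for $n \geq 2$) the classes in $\Sigma_n$ correspond
  to the orbits of the group of linear polynomials on $n$-element sets.\<close>

definition n_subsets_topology :: "nat \<Rightarrow> 'a::field set topology" where
  "n_subsets_topology n = quotient_topology (distinct_topology n) (\<lambda>a. a ` {1..n})"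

definition Sigma_topology :: "nat \<Rightarrow> 'a::field set set topology" where
  "Sigma_topology n = quotient_topology (n_subsets_topology n) poly_class"

lemma topspace_distinct_topology [simp]: "topspace (distinct_topology n) = distinct_points n"
  unfolding distinct_topology_def distinct_points_def by auto

lemma topspace_n_subsets_topology [simp]: "topspace (n_subsets_topology n) = n_subsets n"
proof -
  have "(\<lambda>a. a ` {1..n}) ` distinct_points n = (n_subsets n :: 'a::field set set)"
  proof (intro equalityI subsetI)
    fix A :: "'a set" assume "A \<in> (\<lambda>a. a ` {1..n}) ` distinct_points n"
    then show "A \<in> n_subsets n"
      by (auto simp: distinct_points_iff n_subsets_def card_image)
  next
    fix A :: "'a set" assume A: "A \<in> n_subsets n"
    then obtain b where b: "bij_betw b {1..n} A"
      using finite_same_card_bij[of "{1..n}" A] by (auto simp: n_subsets_def)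
    let ?a = "restrict b {1..n}"
    have "inj_on ?a {1..n}" "A = ?a ` {1..n}"
      using b by (simp_all add: bij_betw_def inj_on_restrict_eq)
    moreover from this have "?a \<in> distinct_points n"
      by (simp add: distinct_points_iff affine_points_def)
    ultimately show "A \<in> (\<lambda>a. a ` {1..n}) ` distinct_points n" by blast
  qed
  then show ?thesis by (simp add: n_subsets_topology_def)
qed

lemma topspace_Sigma_topology [simp]: "topspace (Sigma_topology n) = Sigma_classes n"
  by (simp add: Sigma_topology_def Sigma_classes_def)

lemma closedin_Sigma_topology_iff:
  "closedin (Sigma_topology n) S \<longleftrightarrow> S \<subseteq> Sigma_classes n \<and>
     closedin (distinct_topology n) {a \<in> distinct_points n. poly_class (a ` {1..n}) \<in> S}"
proof -
  have "quotient_map (distinct_topology n) (Sigma_topology n) (poly_class \<circ> (\<lambda>a. a ` {1..n}))"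
    unfolding Sigma_topology_def
    by (rule quotient_map_compose[OF _ quotient_map_quotient_topology])
       (simp add: n_subsets_topology_def quotient_map_quotient_topology)
  then show ?thesis
    unfolding quotient_map_closedin using closedin_subset[of "Sigma_topology n" S]
    by (auto simp: o_def)
qed

definition char_plane :: "nat \<Rightarrow> (nat \<Rightarrow> 'a::field) \<Rightarrow> (nat \<Rightarrow> nat) \<Rightarrow> (nat \<Rightarrow> 'a) set" where
  "char_plane n b \<sigma> = {x \<in> affine_points n. \<forall>j\<in>{3..n}.
     (b (\<sigma> j) - b (\<sigma> 2)) * x 1 + (b (\<sigma> 1) - b (\<sigma> j)) * x 2 + (b (\<sigma> 2) - b (\<sigma> 1)) * x j = 0}"

text \<open>The enumeration $b_1,\ldots,b_n$ of $B$ is fixed by choice; by the lemma below the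
  resulting set of planes does not depend on it.\<close>

definition char_planes :: "nat \<Rightarrow> 'a::field set \<Rightarrow> (nat \<Rightarrow> 'a) set set" where
  "char_planes n B =
     (let b = (SOME b. bij_betw b {1..n} B) in {char_plane n b \<sigma> | \<sigma>. \<sigma> permutes {1..n}})"

lemma char_planes_eq:
  fixes b :: "nat \<Rightarrow> 'a::field"
  assumes n: "2 \<le> n" and b: "bij_betw b {1..n} B"
  shows "char_planes n B = {char_plane n b \<sigma> | \<sigma>. \<sigma> permutes {1..n}}"
proof -
  have sub: "{char_plane n c \<sigma> | \<sigma>. \<sigma> permutes {1..n}} \<subseteq> {char_plane n d \<sigma> | \<sigma>. \<sigma> permutes {1..n}}"
    if c: "bij_betw c {1..n} B" and d: "bij_betw d {1..n} B" for c d :: "nat \<Rightarrow> 'a"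
  proof clarify
    fix \<sigma> assume \<sigma>: "\<sigma> permutes {1..n}"
    define \<tau> where "\<tau> i = (if i \<in> {1..n} then inv_into {1..n} d (c (\<sigma> i)) else i)" for i
    have "bij_betw (inv_into {1..n} d \<circ> (c \<circ> \<sigma>)) {1..n} {1..n}"
      using bij_betw_trans[OF bij_betw_trans[OF permutes_imp_bij[OF \<sigma>] c] bij_betw_inv_into[OF d]]
      by (simp add: comp_assoc)
    then have "bij_betw \<tau> {1..n} {1..n}"
      by (subst bij_betw_cong[of _ _ "inv_into {1..n} d \<circ> (c \<circ> \<sigma>)"]) (auto simp: \<tau>_def)
    then have \<tau>: "\<tau> permutes {1..n}"
      by (rule bij_imp_permutes) (auto simp: \<tau>_def)
    have dc: "d (\<tau> i) = c (\<sigma> i)" if "i \<in> {1..n}" for i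
    proof -
      have "c (\<sigma> i) \<in> d ` {1..n}"
        using that c d permutes_in_image[OF \<sigma>] unfolding bij_betw_def by blast
      then show ?thesis using that by (simp add: \<tau>_def f_inv_into_f)
    qed
    have "char_plane n c \<sigma> = char_plane n d \<tau>"
      unfolding char_plane_def using n by (auto simp: dc)
    then show "\<exists>\<sigma>'. char_plane n c \<sigma> = char_plane n d \<sigma>' \<and> \<sigma>' permutes {1..n}"
      using \<tau> by blast
  qed
  have "bij_betw (SOME b. bij_betw b {1..n} B) {1..n} B"
    using b by (rule someI[of "\<lambda>b. bij_betw b {1..n} B"])
  then show ?thesis
    unfolding char_planes_def Let_def using sub b by (intro equalityI) blast+
qed

definition chi :: "nat \<Rightarrow> 'a::field set \<Rightarrow> nat" where
  "chi n B = card (char_planes n B)"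

definition exceptional_set :: "nat \<Rightarrow> 'a::field set \<Rightarrow> bool" where
  "exceptional_set n B \<longleftrightarrow> B \<in> n_subsets n \<and> chi n B < fact n"

definition char_permutation :: "'a::field set \<Rightarrow> ('a \<Rightarrow> 'a) \<Rightarrow> bool" where
  "char_permutation B \<tau> \<longleftrightarrow> \<tau> permutes B \<and>
     (\<exists>c. \<forall>b\<in>B. \<forall>b'\<in>B. b \<noteq> b' \<longrightarrow> (\<tau> b - \<tau> b') / (b - b') = c)"

definition char_group :: "'a::field set \<Rightarrow> ('a \<Rightarrow> 'a) monoid" where
  "char_group B = \<lparr>carrier = {\<tau>. char_permutation B \<tau>}, mult = (\<circ>), one = id\<rparr>"

lemma group_char_group: "group (char_group B)"
proof (rule groupI)
  fix \<sigma> \<tau> assume "\<sigma> \<in> carrier (char_group B)" "\<tau> \<in> carrier (char_group B)"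
  then obtain c d where \<sigma>: "\<sigma> permutes B" and \<tau>: "\<tau> permutes B"
    and c: "\<And>b b'. b \<in> B \<Longrightarrow> b' \<in> B \<Longrightarrow> b \<noteq> b' \<Longrightarrow> (\<sigma> b - \<sigma> b') / (b - b') = c"
    and d: "\<And>b b'. b \<in> B \<Longrightarrow> b' \<in> B \<Longrightarrow> b \<noteq> b' \<Longrightarrow> (\<tau> b - \<tau> b') / (b - b') = d"
    by (auto simp: char_group_def char_permutation_def)
  have "((\<sigma> \<circ> \<tau>) b - (\<sigma> \<circ> \<tau>) b') / (b - b') = c * d" if "b \<in> B" "b' \<in> B" "b \<noteq> b'" for b b'
  proof -
    have "\<tau> b \<in> B" "\<tau> b' \<in> B" "\<tau> b \<noteq> \<tau> b'"
      using that \<tau> permutes_in_image[OF \<tau>] permutes_inj[OF \<tau>] by (auto dest: injD)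
    then have "\<sigma> (\<tau> b) - \<sigma> (\<tau> b') = c * (\<tau> b - \<tau> b')"
      using c[of "\<tau> b" "\<tau> b'"] by auto
    also have "\<tau> b - \<tau> b' = d * (b - b')"
      using d[OF that] that by auto
    finally show ?thesis
      using that by simp
  qed
  then show "\<sigma> \<otimes>\<^bsub>char_group B\<^esub> \<tau> \<in> carrier (char_group B)"
    using permutes_compose[OF \<tau> \<sigma>] by (auto simp: char_group_def char_permutation_def)
next
  show "\<one>\<^bsub>char_group B\<^esub> \<in> carrier (char_group B)"
    by (auto simp: char_group_def char_permutation_def permutes_id)
next
  fix \<tau> assume "\<tau> \<in> carrier (char_group B)"
  then obtain d where \<tau>: "\<tau> permutes B"
    and d: "\<And>b b'. b \<in> B \<Longrightarrow> b' \<in> B \<Longrightarrow> b \<noteq> b' \<Longrightarrow> (\<tau> b - \<tau> b') / (b - b') = d"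
    by (auto simp: char_group_def char_permutation_def)
  let ?i = "Hilbert_Choice.inv \<tau>"
  have i: "?i permutes B" using \<tau> by (rule permutes_inv)
  have "(?i b - ?i b') / (b - b') = 1 / d" if "b \<in> B" "b' \<in> B" "b \<noteq> b'" for b b'
  proof -
    have "?i b \<in> B" "?i b' \<in> B" "?i b \<noteq> ?i b'"
      using that permutes_in_image[OF i] permutes_inj[OF i] by (auto dest: injD)
    then have d': "(b - b') / (?i b - ?i b') = d"
      using d[of "?i b" "?i b'"] permutes_inverses(1)[OF \<tau>] by auto
    show ?thesis
      unfolding d'[symmetric] by simp
  qed
  then have "?i \<in> carrier (char_group B)"
    using i by (auto simp: char_group_def char_permutation_def)
  moreover have "?i \<otimes>\<^bsub>char_group B\<^esub> \<tau> = \<one>\<^bsub>char_group B\<^esub>"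
    using permutes_inv_o(2)[OF \<tau>] by (simp add: char_group_def)
  ultimately show "\<exists>\<sigma>\<in>carrier (char_group B). \<sigma> \<otimes>\<^bsub>char_group B\<^esub> \<tau> = \<one>\<^bsub>char_group B\<^esub>"
    by blast
qed (auto simp: char_group_def comp_assoc)

definition exceptional_classes :: "nat \<Rightarrow> 'a::field set set set" where
  "exceptional_classes n = {poly_class B | B. exceptional_set n B}"

definition even_exceptional_classes :: "nat \<Rightarrow> 'a::field set set set" where
  "even_exceptional_classes n =
     {poly_class B | B. exceptional_set n B \<and> even (Coset.order (char_group B))}"

end

theory Submission
  imports Defs "HOL-Algebra.Sylow" "HOL-Algebra.Multiplicative_Group"
begin

text \<open>
  The preimage of either set among the tuples with distinct coordinates is a finite union of
  solution sets of polynomial equations. Call a permutation \<open>\<rho>\<close> of the indices a symmetry of the tuple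
  \<open>a\<close> if the permuted tuple is an affine function of the original one, that is
  \<open>a (\<rho> j) = u * a j + v\<close> with \<open>u\<close> and \<open>v\<close> independent of \<open>j\<close>.

  The characteristic plane of \<open>\<sigma>\<close> consists of the tuples that are affine functions of the permuted
  tuple \<open>b \<circ> \<sigma>\<close>. So two planes agree exactly if \<open>b \<circ> \<sigma>\<close> and \<open>b \<circ> \<tau>\<close> are affine functions of each
  other, and the set enumerated by \<open>b\<close> is exceptional if and only if \<open>b\<close> has a symmetry other than
  the identity (\<open>exceptional_set_iff_symmetry\<close>). The characteristic permutations are the symmetries
  transported from indices to elements. A finite group has even order if and only if it contains an
  involution, so the group has even order if and only if \<open>b\<close> has an involutive symmetry
  (\<open>even_char_group_iff_involutive_symmetry\<close>).

  For one fixed \<open>\<rho>\<close>, the points with symmetry \<open>\<rho>\<close> form a closed set: the slope \<open>u\<close> is determined by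
  the first two coordinates, and clearing its denominator leaves polynomial equations
  (\<open>closedin_symmetric_points\<close>). Both preimages are finite unions of such sets, provided that having
  a given kind of symmetry depends only on the class. It does, because equivalent sets of equal
  size at least two are affine images of each other (\<open>poly_le_card_eq_imp_affine\<close>), and this is where
  the field has to be algebraically closed of characteristic zero.
\<close>

section \<open>Affine relations between finite families\<close>

text \<open>The slope \<open>u\<close> may vanish, so the relation is not symmetric: any family is related to every
  constant one. With this convention the families related to a fixed one form a linear subspace,
  as the points of a characteristic plane do.\<close>

definition affinely_related :: "'i set \<Rightarrow> ('i \<Rightarrow> 'a::field) \<Rightarrow> ('i \<Rightarrow> 'a) \<Rightarrow> bool" where
  "affinely_related S f g \<longleftrightarrow> (\<exists>u v. \<forall>j\<in>S. g j = u * f j + v)"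

lemma affinely_relatedI: "(\<And>j. j \<in> S \<Longrightarrow> g j = u * f j + v) \<Longrightarrow> affinely_related S f g"
  unfolding affinely_related_def by blast

lemma affinely_related_refl: "affinely_related S f f"
  by (rule affinely_relatedI[where u = 1 and v = 0]) simp

lemma affinely_related_trans:
  assumes "affinely_related S f g" "affinely_related S g h"
  shows "affinely_related S f h"
proof -
  obtain u v u' v' where "\<And>j. j \<in> S \<Longrightarrow> g j = u * f j + v" "\<And>j. j \<in> S \<Longrightarrow> h j = u' * g j + v'"
    using assms unfolding affinely_related_def by blast
  then show ?thesis
    by (intro affinely_relatedI[where u = "u' * u" and v = "u' * v + v'"]) (simp add: algebra_simps)
qed

lemma affinely_related_sym:
  assumes fg: "affinely_related S f g" and i: "i \<in> S" "j \<in> S" "g i \<noteq> g j"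
  shows "affinely_related S g f"
proof -
  obtain u v where uv: "\<And>j. j \<in> S \<Longrightarrow> g j = u * f j + v"
    using fg unfolding affinely_related_def by blast
  then have "u \<noteq> 0" using i by auto
  then show ?thesis
    by (intro affinely_relatedI[where u = "1 / u" and v = "- v / u"]) (simp add: uv field_simps)
qed

lemma affinely_related_reindex:
  "affinely_related (h ` S) f g \<longleftrightarrow> affinely_related S (f \<circ> h) (g \<circ> h)"
  unfolding affinely_related_def by simp

lemma affinely_related_cong:
  assumes "\<And>j. j \<in> S \<Longrightarrow> f j = f' j" "\<And>j. j \<in> S \<Longrightarrow> g j = g' j"
  shows "affinely_related S f g \<longleftrightarrow> affinely_related S f' g'"
  unfolding affinely_related_def using assms by simp

text \<open>An affine function is determined by its values at two distinct points, so the existential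
  quantifiers over \<open>u\<close> and \<open>v\<close> can be eliminated; this leaves equations that are polynomial
  in the values of both families.\<close>

lemma affinely_related_iff_equations:
  assumes i: "i \<in> S" "i' \<in> S" "f i \<noteq> f i'"
  shows "affinely_related S f g \<longleftrightarrow>
    (\<forall>j\<in>S. (g j - g i) * (f i' - f i) = (g i' - g i) * (f j - f i))"
proof
  assume "affinely_related S f g"
  then obtain u v where "\<And>j. j \<in> S \<Longrightarrow> g j = u * f j + v"
    unfolding affinely_related_def by blast
  then show "\<forall>j\<in>S. (g j - g i) * (f i' - f i) = (g i' - g i) * (f j - f i)"
    using i by (simp add: algebra_simps)
next
  assume *: "\<forall>j\<in>S. (g j - g i) * (f i' - f i) = (g i' - g i) * (f j - f i)"
  define u where "u = (g i' - g i) / (f i' - f i)"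
  have "g j = u * f j + (g i - u * f i)" if "j \<in> S" for j
  proof -
    have "g j - g i = u * (f j - f i)"
      using * that i(3) by (simp add: u_def eq_divide_eq)
    then show ?thesis by (simp add: algebra_simps)
  qed
  then show "affinely_related S f g" by (rule affinely_relatedI)
qed

section \<open>Equivalent sets of equal size are affine images of each other\<close>

text \<open>A polynomial that takes one of its values only at \<open>a\<close> has the form \<open>c (X - a)\<^sup>d + c'\<close>, because
  the field is algebraically closed; its derivative can vanish only at \<open>a\<close>.\<close>

lemma critical_point_of_unique_preimage:
  fixes P :: "'a::{alg_closed_field, field_char_0} poly"
  assumes deg: "degree P > 0" and uniq: "\<And>x. poly P x = poly P a \<Longrightarrow> x = a"
    and crit: "poly (pderiv P) z = 0"
  shows "z = a"
proof -
  define Q where "Q = P - [:poly P a:]"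
  have "Q \<noteq> 0"
  proof
    assume "Q = 0"
    then have "P = [:poly P a:]" by (simp add: Q_def)
    then have "degree P = 0" by (metis degree_pCons_0)
    then show False using deg by simp
  qed
  then obtain R where R: "Q = [:- a, 1:] ^ Polynomial.order a Q * R" "\<not> [:- a, 1:] dvd R"
    using order_decomp by blast
  have "poly R x \<noteq> 0" for x
  proof
    assume "poly R x = 0"
    then have "poly Q x = 0" by (subst R(1)) simp
    then have "x = a" using uniq by (simp add: Q_def)
    then show False using R(2) \<open>poly R x = 0\<close> by (simp add: poly_eq_0_iff_dvd)
  qed
  then have "degree R = 0" using alg_closed_imp_poly_has_root[of R] by blast
  then obtain c where c: "R = [:c:]" by (rule degree_eq_zeroE)
  have "c \<noteq> 0" using \<open>\<And>x. poly R x \<noteq> 0\<close> by (auto simp: c)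
  have "poly Q a = 0" by (simp add: Q_def)
  then have "Polynomial.order a Q \<noteq> 0" using \<open>Q \<noteq> 0\<close> by (simp add: order_root)
  then obtain m where m: "Polynomial.order a Q = Suc m" by (cases "Polynomial.order a Q") auto
  have "Q = Polynomial.smult c ([:- a, 1:] ^ Suc m)"
    using R(1) unfolding m c by (simp del: power_Suc)
  then have "P = Polynomial.smult c ([:- a, 1:] ^ Suc m) + [:poly P a:]"
    unfolding Q_def by (simp only: diff_eq_eq)
  then have "pderiv P = pderiv (Polynomial.smult c ([:- a, 1:] ^ Suc m) + [:poly P a:])"
    by (rule arg_cong)
  also have "\<dots> = Polynomial.smult c (Polynomial.smult (of_nat (Suc m)) ([:- a, 1:] ^ m))"
    by (simp add: pderiv_add pderiv_smult pderiv_power_Suc pderiv_pCons del: power_Suc of_nat_Suc)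
  finally have "pderiv P = Polynomial.smult c (Polynomial.smult (of_nat (Suc m)) ([:- a, 1:] ^ m))" .
  then have "of_nat (Suc m) * (z - a) ^ m = 0"
    using crit \<open>c \<noteq> 0\<close> by (simp add: poly_power del: of_nat_Suc)
  then have "(z - a) ^ m = 0" by (simp only: mult_eq_0_iff of_nat_eq_0_iff) simp
  then show ?thesis by simp
qed

text \<open>A nonconstant polynomial is surjective because the field is algebraically closed. If the
  preimage \<open>A\<close> of a finite set has the same size as the set, then every point of the set therefore
  has exactly one preimage. A critical point would have to equal each of these preimages, and there
  are at least two, so there is none and the polynomial is linear.\<close>

lemma poly_le_card_eq_imp_affine:
  fixes A B :: "'a::{alg_closed_field, field_char_0} set"
  assumes le: "A \<le>\<^sub>p B" and fin: "finite A" and card: "card A = card B" "card A \<ge> 2"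
  obtains u v where "u \<noteq> 0" "B = (\<lambda>x. u * x + v) ` A"
proof -
  obtain P :: "'a poly" where P: "A = poly P -` B" using le unfolding poly_le_def by blast
  have deg: "degree P > 0"
  proof (rule ccontr)
    assume "\<not> degree P > 0"
    then obtain c where "P = [:c:]" by (auto elim: degree_eq_zeroE)
    then have "A = {} \<or> A = UNIV" by (auto simp: P)
    then show False using fin card(2) infinite_UNIV_char_0[where 'a = 'a] by auto
  qed
  have surj: "\<exists>x. poly P x = y" for y
  proof -
    have "degree (P + [:- y:]) > 0" using deg by (simp add: degree_add_eq_left)
    from alg_closed_imp_poly_has_root[OF this] show ?thesis by auto
  qed
  have img: "poly P ` A = B"
    unfolding P using surj by (metis surj_def surj_image_vimage_eq)
  have inj: "inj_on (poly P) A"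
    by (rule eq_card_imp_inj_on) (use fin card in \<open>simp_all add: img\<close>)
  have uniq: "x = a" if "a \<in> A" "poly P x = poly P a" for a x
    using that inj unfolding P inj_on_def by auto
  have "degree (pderiv P) = 0"
  proof (rule ccontr)
    assume "degree (pderiv P) \<noteq> 0"
    then obtain z where "poly (pderiv P) z = 0" using alg_closed_imp_poly_has_root by blast
    then have "A \<subseteq> {z}" using critical_point_of_unique_preimage[OF deg uniq] by blast
    then have "card A \<le> 1" using card_mono[of "{z}" A] by simp
    then show False using card(2) by simp
  qed
  then have "degree P = 1" using deg by (simp add: degree_pderiv)
  then obtain u v where uv: "P = [:v, u:]" "u \<noteq> 0" by (rule degree1_coeffs)
  show thesis
  proof
    show "B = (\<lambda>x. u * x + v) ` A" using img by (simp add: uv add.commute mult.commute)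
  qed (fact uv(2))
qed

section \<open>Exceptional sets and symmetries of an enumeration\<close>

text \<open>The equation with index \<open>j\<close> says that the affine function through the values at the indices
  \<open>1\<close> and \<open>2\<close> also gives the value at \<open>j\<close>. It is trivial for \<open>j = 1\<close> and \<open>j = 2\<close>, so the
  system for \<open>j \<ge> 3\<close> expresses an affine relation over all of \<open>{1..n}\<close>.\<close>

lemma char_plane_affinely_related:
  assumes n: "n \<ge> 2" and b: "inj_on b {1..n}" and \<sigma>: "\<sigma> permutes {1..n}"
  shows "char_plane n b \<sigma> = {x \<in> affine_points n. affinely_related {1..n} (b \<circ> \<sigma>) x}"
proof -
  have "inj_on (b \<circ> \<sigma>) {1..n}"
    using b \<sigma> by (simp add: comp_inj_on permutes_image permutes_inj_on)
  then have ne: "b (\<sigma> 1) \<noteq> b (\<sigma> 2)"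
    using n by (auto dest: inj_onD[where x = 1 and y = 2])
  have split: "{1..n} = {1, 2} \<union> {3..n}" using n by auto
  have "affinely_related {1..n} (b \<circ> \<sigma>) x \<longleftrightarrow> (\<forall>j\<in>{3..n}.
     (b (\<sigma> j) - b (\<sigma> 2)) * x 1 + (b (\<sigma> 1) - b (\<sigma> j)) * x 2 + (b (\<sigma> 2) - b (\<sigma> 1)) * x j = 0)" for x
  proof -
    have "affinely_related {1..n} (b \<circ> \<sigma>) x \<longleftrightarrow> (\<forall>j\<in>{1..n}.
        (x j - x 1) * (b (\<sigma> 2) - b (\<sigma> 1)) = (x 2 - x 1) * (b (\<sigma> j) - b (\<sigma> 1)))"
      using n ne by (subst affinely_related_iff_equations[of 1 _ 2]) auto
    also have "\<dots> \<longleftrightarrow> (\<forall>j\<in>{3..n}.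
        (x j - x 1) * (b (\<sigma> 2) - b (\<sigma> 1)) = (x 2 - x 1) * (b (\<sigma> j) - b (\<sigma> 1)))"
      unfolding split by simp
    also have "\<dots> \<longleftrightarrow> (\<forall>j\<in>{3..n}.
     (b (\<sigma> j) - b (\<sigma> 2)) * x 1 + (b (\<sigma> 1) - b (\<sigma> j)) * x 2 + (b (\<sigma> 2) - b (\<sigma> 1)) * x j = 0)"
    proof (intro ball_cong refl)
      fix j
      have "(b (\<sigma> j) - b (\<sigma> 2)) * x 1 + (b (\<sigma> 1) - b (\<sigma> j)) * x 2 + (b (\<sigma> 2) - b (\<sigma> 1)) * x j
          = (x j - x 1) * (b (\<sigma> 2) - b (\<sigma> 1)) - (x 2 - x 1) * (b (\<sigma> j) - b (\<sigma> 1))"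
        by (simp add: algebra_simps)
      then show "(x j - x 1) * (b (\<sigma> 2) - b (\<sigma> 1)) = (x 2 - x 1) * (b (\<sigma> j) - b (\<sigma> 1)) \<longleftrightarrow>
          (b (\<sigma> j) - b (\<sigma> 2)) * x 1 + (b (\<sigma> 1) - b (\<sigma> j)) * x 2 + (b (\<sigma> 2) - b (\<sigma> 1)) * x j = 0"
        by (simp only: right_minus_eq)
    qed
    finally show ?thesis .
  qed
  then show ?thesis unfolding char_plane_def by simp
qed

lemma char_plane_eq_iff:
  assumes n: "n \<ge> 2" and b: "inj_on b {1..n}"
    and \<sigma>: "\<sigma> permutes {1..n}" and \<tau>: "\<tau> permutes {1..n}"
  shows "char_plane n b \<sigma> = char_plane n b \<tau> \<longleftrightarrow> affinely_related {1..n} (b \<circ> \<tau>) (b \<circ> \<sigma>)"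
proof
  \<comment> \<open>points of affine space are extensional, so \<open>b \<circ> \<sigma>\<close> itself need not be one\<close>
  let ?p = "restrict (b \<circ> \<sigma>) {1..n}"
  have p: "affinely_related {1..n} f ?p \<longleftrightarrow> affinely_related {1..n} f (b \<circ> \<sigma>)" for f
    by (rule affinely_related_cong) auto
  assume "char_plane n b \<sigma> = char_plane n b \<tau>"
  moreover have "?p \<in> char_plane n b \<sigma>"
    by (simp add: char_plane_affinely_related[OF n b \<sigma>] p affinely_related_refl affine_points_def
        del: One_nat_def)
  ultimately show "affinely_related {1..n} (b \<circ> \<tau>) (b \<circ> \<sigma>)"
    by (simp add: char_plane_affinely_related[OF n b \<tau>] p del: One_nat_def)
next
  assume *: "affinely_related {1..n} (b \<circ> \<tau>) (b \<circ> \<sigma>)"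
  have "inj_on (b \<circ> \<sigma>) {1..n}"
    using b \<sigma> by (simp add: comp_inj_on permutes_image permutes_inj_on)
  then have "(b \<circ> \<sigma>) 1 \<noteq> (b \<circ> \<sigma>) 2"
    using n by (auto dest: inj_onD[where x = 1 and y = 2])
  then have "affinely_related {1..n} (b \<circ> \<sigma>) (b \<circ> \<tau>)"
    using n by (intro affinely_related_sym[OF *, of 1 2]) auto
  then show "char_plane n b \<sigma> = char_plane n b \<tau>"
    using * affinely_related_trans
    unfolding char_plane_affinely_related[OF n b \<sigma>] char_plane_affinely_related[OF n b \<tau>]
    by blast
qed

text \<open>There are fewer than \<open>n!\<close> planes exactly if two permutations \<open>\<sigma>\<close>, \<open>\<tau>\<close> give the same
  plane, and then \<open>\<sigma> \<circ> \<tau>\<^sup>-\<^sup>1\<close> is a symmetry of the enumeration.\<close>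

lemma exceptional_set_iff_symmetry:
  assumes n: "n \<ge> 2" and b: "inj_on b {1..n}"
  shows "exceptional_set n (b ` {1..n}) \<longleftrightarrow>
    (\<exists>\<rho>. \<rho> permutes {1..n} \<and> \<rho> \<noteq> id \<and> affinely_related {1..n} b (b \<circ> \<rho>))"
proof -
  let ?S = "{\<sigma>. \<sigma> permutes {1..n}}"
  have card: "card ?S = fact n" by (simp add: card_permutations)
  have fin: "finite ?S" by (simp add: finite_permutations)
  have planes: "char_planes n (b ` {1..n}) = char_plane n b ` ?S"
    using char_planes_eq[OF n inj_on_imp_bij_betw[OF b]] by blast
  have "b ` {1..n} \<in> n_subsets n" using b by (simp add: n_subsets_def card_image)
  then have "exceptional_set n (b ` {1..n}) \<longleftrightarrow> card (char_plane n b ` ?S) < card ?S"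
    unfolding exceptional_set_def chi_def planes card by simp
  also have "\<dots> \<longleftrightarrow> \<not> inj_on (char_plane n b) ?S"
    using card_image_le[OF fin, of "char_plane n b"] eq_card_imp_inj_on[OF fin, of "char_plane n b"]
    by (metis card_image le_neq_implies_less less_irrefl)
  also have "\<dots> \<longleftrightarrow> (\<exists>\<rho>. \<rho> permutes {1..n} \<and> \<rho> \<noteq> id \<and> affinely_related {1..n} b (b \<circ> \<rho>))"
  proof
    assume "\<not> inj_on (char_plane n b) ?S"
    then obtain \<sigma> \<tau> where \<sigma>: "\<sigma> permutes {1..n}" and \<tau>: "\<tau> permutes {1..n}" and "\<sigma> \<noteq> \<tau>"
      and "char_plane n b \<sigma> = char_plane n b \<tau>"
      unfolding inj_on_def by blast
    then have "affinely_related {1..n} (b \<circ> \<tau>) (b \<circ> \<sigma>)"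
      using char_plane_eq_iff[OF n b \<sigma> \<tau>] by simp
    moreover have "b \<circ> \<sigma> = (b \<circ> (\<sigma> \<circ> Hilbert_Choice.inv \<tau>)) \<circ> \<tau>"
      by (simp add: comp_assoc permutes_inv_o(2)[OF \<tau>])
    ultimately have "affinely_related (\<tau> ` {1..n}) b (b \<circ> (\<sigma> \<circ> Hilbert_Choice.inv \<tau>))"
      by (simp add: affinely_related_reindex)
    then have "affinely_related {1..n} b (b \<circ> (\<sigma> \<circ> Hilbert_Choice.inv \<tau>))"
      by (simp only: permutes_image[OF \<tau>])
    moreover have "\<sigma> \<circ> Hilbert_Choice.inv \<tau> permutes {1..n}"
      by (rule permutes_compose[OF permutes_inv[OF \<tau>] \<sigma>])
    moreover have "\<sigma> \<circ> Hilbert_Choice.inv \<tau> \<noteq> id"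
    proof
      assume "\<sigma> \<circ> Hilbert_Choice.inv \<tau> = id"
      then have "\<sigma> \<circ> (Hilbert_Choice.inv \<tau> \<circ> \<tau>) = \<tau>" by (simp flip: comp_assoc)
      then show False using \<open>\<sigma> \<noteq> \<tau>\<close> by (simp add: permutes_inv_o(2)[OF \<tau>])
    qed
    ultimately show "\<exists>\<rho>. \<rho> permutes {1..n} \<and> \<rho> \<noteq> id \<and> affinely_related {1..n} b (b \<circ> \<rho>)"
      by blast
  next
    assume "\<exists>\<rho>. \<rho> permutes {1..n} \<and> \<rho> \<noteq> id \<and> affinely_related {1..n} b (b \<circ> \<rho>)"
    then obtain \<rho> where "\<rho> permutes {1..n}" "\<rho> \<noteq> id" "affinely_related {1..n} b (b \<circ> \<rho>)"
      by blast
    then have "char_plane n b \<rho> = char_plane n b id"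
      using char_plane_eq_iff[OF n b _ permutes_id] by simp
    then show "\<not> inj_on (char_plane n b) ?S"
      using \<open>\<rho> permutes {1..n}\<close> \<open>\<rho> \<noteq> id\<close> permutes_id by (auto dest: inj_onD)
  qed
  finally show ?thesis .
qed

section \<open>Characteristic groups of even order\<close>

lemma (in group) even_order_iff_involution:
  assumes fin: "finite (carrier G)"
  shows "even (Coset.order G) \<longleftrightarrow> (\<exists>g\<in>carrier G. g \<noteq> \<one> \<and> g \<otimes> g = \<one>)"
proof
  assume "even (Coset.order G)"
  then obtain m where "Coset.order G = 2 ^ 1 * m" by auto
  then obtain H where H: "subgroup H G" "card H = 2"
    using sylow_thm[of 2 G 1 m] fin is_group by auto
  interpret H: subgroup H G by (fact H(1))
  obtain x y where xy: "H = {x, y}" "x \<noteq> y" using H(2) by (auto simp: card_2_iff)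
  then have "\<one> = x \<or> \<one> = y" using H.one_closed by simp
  then obtain h where h: "h \<noteq> \<one>" "H = {\<one>, h}" using xy by (metis insert_commute)
  then have hG: "h \<in> carrier G" and "h \<otimes> h \<in> {\<one>, h}"
    using H.subset H.m_closed[of h h] by auto
  then have "h \<otimes> h = \<one>" using h(1) by (auto simp: l_cancel_one)
  then show "\<exists>g\<in>carrier G. g \<noteq> \<one> \<and> g \<otimes> g = \<one>" using h(1) hG by blast
next
  assume "\<exists>g\<in>carrier G. g \<noteq> \<one> \<and> g \<otimes> g = \<one>"
  then obtain g where g: "g \<in> carrier G" "g \<noteq> \<one>" "g \<otimes> g = \<one>" by blast
  then have "g [^] (2::nat) = \<one>" by (simp add: numeral_2_eq_2)
  then have "ord g dvd 2" using g(1) by (simp add: pow_eq_id)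
  moreover have "ord g \<noteq> 1" using g(1,2) ord_eq_1 by blast
  ultimately have "ord g = 2" by (metis two_is_prime_nat prime_nat_iff)
  then show "even (Coset.order G)" using ord_dvd_group_order[OF g(1)] by simp
qed

lemma permutes_involutionI:
  assumes "\<And>x. x \<notin> S \<Longrightarrow> p x = x" "p \<circ> p = id"
  shows "p permutes S"
  unfolding permutes_def using assms by (metis comp_apply id_apply)

text \<open>This moves an involutive characteristic permutation from elements to indices when \<open>f\<close> is the
  enumeration, and from indices to elements when \<open>f\<close> is its inverse.\<close>

lemma transport_involution:
  assumes f: "bij_betw f S T" and \<tau>: "\<tau> permutes T" "\<tau> \<noteq> id" "\<tau> \<circ> \<tau> = id"
  obtains \<rho> where "\<rho> permutes S" "\<rho> \<noteq> id" "\<rho> \<circ> \<rho> = id" "\<And>j. j \<in> S \<Longrightarrow> f (\<rho> j) = \<tau> (f j)"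
proof -
  let ?g = "inv_into S f"
  define \<rho> where "\<rho> j = (if j \<in> S then ?g (\<tau> (f j)) else j)" for j
  have \<tau>T: "\<tau> x \<in> T \<longleftrightarrow> x \<in> T" for x by (rule permutes_in_image[OF \<tau>(1)])
  have \<tau>\<tau>: "\<tau> (\<tau> x) = x" for x using \<tau>(3) by (metis comp_apply id_apply)
  have fT: "f j \<in> T" if "j \<in> S" for j using f that by (auto simp: bij_betw_def)
  have f\<rho>: "f (\<rho> j) = \<tau> (f j)" if "j \<in> S" for j
    using that bij_betw_inv_into_right[OF f, of "\<tau> (f j)"] by (simp add: \<rho>_def \<tau>T fT)
  have \<rho>S: "\<rho> j \<in> S" if "j \<in> S" for j
    using that bij_betw_apply[OF bij_betw_inv_into[OF f], of "\<tau> (f j)"] by (simp add: \<rho>_def \<tau>T fT)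
  have "\<rho> (\<rho> j) = j" for j
  proof (cases "j \<in> S")
    case True
    then have "f (\<rho> (\<rho> j)) = f j" by (simp add: f\<rho> \<rho>S \<tau>\<tau>)
    then show ?thesis using True f \<rho>S by (auto simp: bij_betw_def inj_on_def)
  qed (simp add: \<rho>_def)
  then have \<rho>\<rho>: "\<rho> \<circ> \<rho> = id" by auto
  show thesis
  proof
    show "\<rho> permutes S" by (rule permutes_involutionI[OF _ \<rho>\<rho>]) (simp add: \<rho>_def)
    obtain x where "\<tau> x \<noteq> x" using \<tau>(2) by (auto simp: fun_eq_iff)
    then have "x \<in> T" using \<tau>(1) by (auto simp: permutes_def)
    then obtain j where "j \<in> S" "x = f j" using f by (auto simp: bij_betw_def)
    then show "\<rho> \<noteq> id" using f\<rho>[of j] \<open>\<tau> x \<noteq> x\<close> by auto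
  qed (fact \<rho>\<rho>, fact f\<rho>)
qed

lemma char_permutation_iff_affinely_related:
  assumes "B \<noteq> {}"
  shows "char_permutation B \<tau> \<longleftrightarrow> \<tau> permutes B \<and> affinely_related B id \<tau>"
proof -
  have "(\<exists>c. \<forall>b\<in>B. \<forall>b'\<in>B. b \<noteq> b' \<longrightarrow> (\<tau> b - \<tau> b') / (b - b') = c) \<longleftrightarrow> affinely_related B id \<tau>"
  proof
    assume "\<exists>c. \<forall>b\<in>B. \<forall>b'\<in>B. b \<noteq> b' \<longrightarrow> (\<tau> b - \<tau> b') / (b - b') = c"
    then obtain c where c: "\<forall>b\<in>B. \<forall>b'\<in>B. b \<noteq> b' \<longrightarrow> (\<tau> b - \<tau> b') / (b - b') = c"
      by (rule exE)
    obtain b' where b': "b' \<in> B" using assms by blast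
    have "\<tau> b = c * id b + (\<tau> b' - c * b')" if "b \<in> B" for b
    proof (cases "b = b'")
      case False
      then have "\<tau> b - \<tau> b' = c * (b - b')" using c that b' False by (simp add: divide_eq_eq)
      then show ?thesis by (simp add: algebra_simps)
    qed simp
    then show "affinely_related B id \<tau>" by (rule affinely_relatedI)
  next
    assume "affinely_related B id \<tau>"
    then obtain u v where uv: "\<And>b. b \<in> B \<Longrightarrow> \<tau> b = u * b + v"
      unfolding affinely_related_def by auto
    have "(\<tau> b - \<tau> b') / (b - b') = u" if "b \<in> B" "b' \<in> B" "b \<noteq> b'" for b b'
    proof -
      have "\<tau> b - \<tau> b' = u * (b - b')" by (simp add: uv that algebra_simps)
      then show ?thesis using that(3) by simp
    qed
    then show "\<exists>c. \<forall>b\<in>B. \<forall>b'\<in>B. b \<noteq> b' \<longrightarrow> (\<tau> b - \<tau> b') / (b - b') = c"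
      by (intro exI[of _ u]) simp
  qed
  then show ?thesis unfolding char_permutation_def by simp
qed

lemma even_char_group_iff_involutive_symmetry:
  assumes "finite S" "S \<noteq> {}" and a: "inj_on a S"
  shows "even (Coset.order (char_group (a ` S))) \<longleftrightarrow>
    (\<exists>\<rho>. \<rho> permutes S \<and> \<rho> \<noteq> id \<and> \<rho> \<circ> \<rho> = id \<and> affinely_related S a (a \<circ> \<rho>))"
proof -
  let ?B = "a ` S"
  interpret group "char_group ?B" by (rule group_char_group)
  have char: "char_permutation ?B \<tau> \<longleftrightarrow> \<tau> permutes ?B \<and> affinely_related S a (\<tau> \<circ> a)" for \<tau>
    using assms(2) by (simp add: char_permutation_iff_affinely_related affinely_related_reindex)
  have "finite (carrier (char_group ?B))"
    by (rule finite_subset[OF _ finite_permutations[of ?B]])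
       (use assms(1) in \<open>auto simp: char_group_def char_permutation_def\<close>)
  from even_order_iff_involution[OF this]
  have "even (Coset.order (char_group ?B)) \<longleftrightarrow>
      (\<exists>\<tau>. \<tau> permutes ?B \<and> affinely_related S a (\<tau> \<circ> a) \<and> \<tau> \<noteq> id \<and> \<tau> \<circ> \<tau> = id)"
    by (auto simp: char_group_def char)
  also have "\<dots> \<longleftrightarrow> (\<exists>\<rho>. \<rho> permutes S \<and> \<rho> \<noteq> id \<and> \<rho> \<circ> \<rho> = id \<and> affinely_related S a (a \<circ> \<rho>))"
  proof (intro iffI; elim exE conjE)
    fix \<tau> assume \<tau>: "\<tau> permutes ?B" "affinely_related S a (\<tau> \<circ> a)" "\<tau> \<noteq> id" "\<tau> \<circ> \<tau> = id"
    obtain \<rho> where \<rho>: "\<rho> permutes S" "\<rho> \<noteq> id" "\<rho> \<circ> \<rho> = id" "\<And>j. j \<in> S \<Longrightarrow> a (\<rho> j) = \<tau> (a j)"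
      using transport_involution[OF inj_on_imp_bij_betw[OF a] \<tau>(1,3,4)] by blast
    have "affinely_related S a (a \<circ> \<rho>)"
      using \<tau>(2) by (subst affinely_related_cong[where g' = "\<tau> \<circ> a"]) (auto simp: \<rho>(4))
    then show "\<exists>\<rho>. \<rho> permutes S \<and> \<rho> \<noteq> id \<and> \<rho> \<circ> \<rho> = id \<and> affinely_related S a (a \<circ> \<rho>)"
      using \<rho> by blast
  next
    fix \<rho> assume \<rho>: "\<rho> permutes S" "\<rho> \<noteq> id" "\<rho> \<circ> \<rho> = id" "affinely_related S a (a \<circ> \<rho>)"
    obtain \<tau> where \<tau>: "\<tau> permutes ?B" "\<tau> \<noteq> id" "\<tau> \<circ> \<tau> = id"
        "\<And>x. x \<in> ?B \<Longrightarrow> inv_into S a (\<tau> x) = \<rho> (inv_into S a x)"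
      using transport_involution[OF bij_betw_inv_into[OF inj_on_imp_bij_betw[OF a]] \<rho>(1-3)] by blast
    have "\<tau> (a j) = a (\<rho> j)" if "j \<in> S" for j
    proof -
      have "\<tau> (a j) \<in> ?B" using that permutes_in_image[OF \<tau>(1)] by blast
      then have "\<tau> (a j) = a (inv_into S a (\<tau> (a j)))" by (simp add: f_inv_into_f)
      also have "\<dots> = a (\<rho> j)" using that a by (simp add: \<tau>(4))
      finally show ?thesis .
    qed
    then have "affinely_related S a (\<tau> \<circ> a)"
      using \<rho>(4) by (subst affinely_related_cong[where g' = "a \<circ> \<rho>"]) auto
    then show "\<exists>\<tau>. \<tau> permutes ?B \<and> affinely_related S a (\<tau> \<circ> a) \<and> \<tau> \<noteq> id \<and> \<tau> \<circ> \<tau> = id"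
      using \<tau> by blast
  qed
  finally show ?thesis .
qed

section \<open>Closedness\<close>

definition polynomial_fun :: "nat \<Rightarrow> ((nat \<Rightarrow> 'a::field) \<Rightarrow> 'a) \<Rightarrow> bool" where
  "polynomial_fun n f \<longleftrightarrow> (\<exists>p\<in>multi_polys n. \<forall>a. multi_eval p a = f a)"

lemma polynomial_fun_coordinate:
  assumes "i \<in> {1..n}"
  shows "polynomial_fun n (\<lambda>a. a i)"
  unfolding polynomial_fun_def
proof (intro bexI allI)
  let ?p = "Poly_Mapping.single (Poly_Mapping.single i 1) 1 :: 'a multi_poly"
  show "?p \<in> multi_polys n" using assms by (simp add: multi_polys_def)
  show "multi_eval ?p a = a i" for a by (simp add: multi_eval_single multi_monom_eval_def)
qed

lemma polynomial_fun_mult: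
  assumes "polynomial_fun n f" "polynomial_fun n g"
  shows "polynomial_fun n (\<lambda>a. f a * g a)"
  using assms mult_in_multi_polys multi_eval_mult unfolding polynomial_fun_def by metis

lemma multi_eval_diff:
  fixes p q :: "'a::comm_ring_1 multi_poly"
  shows "multi_eval (p - q) a = multi_eval p a - multi_eval q a"
  using multi_eval_add[of "p - q" q a] by simp

lemma polynomial_fun_diff:
  assumes "polynomial_fun n f" "polynomial_fun n g"
  shows "polynomial_fun n (\<lambda>a. f a - g a)"
proof -
  obtain p q where "p \<in> multi_polys n" "\<And>a. multi_eval p a = f a"
      and "q \<in> multi_polys n" "\<And>a. multi_eval q a = g a"
    using assms unfolding polynomial_fun_def by blast
  moreover from this have "p - q \<in> multi_polys n"
    using keys_diff[of p q] unfolding multi_polys_def by blast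
  ultimately show ?thesis
    unfolding polynomial_fun_def by (intro bexI[of _ "p - q"]) (auto simp: multi_eval_diff)
qed

lemma closedin_zero_set:
  assumes "\<And>j. j \<in> J \<Longrightarrow> polynomial_fun n (f j)"
  shows "closedin (zariski n) {a \<in> affine_points n. \<forall>j\<in>J. f j a = 0}"
proof -
  obtain p where p: "\<And>j. j \<in> J \<Longrightarrow> p j \<in> multi_polys n"
      "\<And>j a. j \<in> J \<Longrightarrow> multi_eval (p j) a = f j a"
    using assms unfolding polynomial_fun_def by metis
  then have "{a \<in> affine_points n. \<forall>j\<in>J. f j a = 0} = zero_locus n (p ` J)"
    unfolding zero_locus_def by auto
  moreover have "p ` J \<subseteq> multi_polys n" using p(1) by blast
  ultimately show ?thesis unfolding closedin_zariski by blast
qed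

lemma closedin_symmetric_points:
  assumes n: "n \<ge> 2" and \<rho>: "\<rho> permutes {1..n}"
  shows "closedin (distinct_topology n)
    {a \<in> distinct_points n. affinely_related {1..n} a (a \<circ> \<rho>)}"
proof -
  define f where "f j a = (a (\<rho> j) - a (\<rho> 1)) * (a 2 - a 1) - (a (\<rho> 2) - a (\<rho> 1)) * (a j - a 1)"
    for j and a :: "nat \<Rightarrow> 'a"
  have "closedin (zariski n) {a \<in> affine_points n. \<forall>j\<in>{1..n}. f j a = 0}"
  proof (rule closedin_zero_set)
    fix j assume "j \<in> {1..n}"
    moreover have "1 \<in> {1..n}" "2 \<in> {1..n}" using n by auto
    ultimately show "polynomial_fun n (f j)"
      unfolding f_def
      by (intro polynomial_fun_diff polynomial_fun_mult polynomial_fun_coordinate)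
         (simp_all only: permutes_in_image[OF \<rho>])
  qed
  moreover have "affinely_related {1..n} a (a \<circ> \<rho>) \<longleftrightarrow> (\<forall>j\<in>{1..n}. f j a = 0)"
    if "a \<in> distinct_points n" for a
  proof -
    have "a 1 \<noteq> a 2"
      using that n by (auto simp: distinct_points_iff dest: inj_onD[where x = 1 and y = 2])
    then show ?thesis
      using n by (subst affinely_related_iff_equations[of 1 _ 2]) (auto simp: f_def)
  qed
  then have "{a \<in> distinct_points n. affinely_related {1..n} a (a \<circ> \<rho>)}
      = {a \<in> affine_points n. \<forall>j\<in>{1..n}. f j a = 0} \<inter> distinct_points n"
    by (auto simp: distinct_points_iff)
  ultimately show ?thesis
    unfolding distinct_topology_def closedin_subtopology by blast
qed

text \<open>Symmetries do not change under a linear change of coordinates. So a property of sets that is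
  expressed by the symmetries of an enumeration descends to classes.\<close>

lemma closedin_Sigma_of_symmetries:
  fixes Q :: "'k::{alg_closed_field, field_char_0} set \<Rightarrow> bool"
  assumes n: "n \<ge> 2"
    and sub: "\<And>B. Q B \<Longrightarrow> B \<in> n_subsets n"
    and sym: "\<And>b. inj_on b {1..n} \<Longrightarrow>
      Q (b ` {1..n}) \<longleftrightarrow> (\<exists>\<rho>. \<rho> permutes {1..n} \<and> R \<rho> \<and> affinely_related {1..n} b (b \<circ> \<rho>))"
  shows "closedin (Sigma_topology n) {poly_class B | B. Q B}"
proof -
  have descend: "Q (a ` {1..n})"
    if a: "a \<in> distinct_points n" and B: "Q B" and eq: "poly_class (a ` {1..n}) = poly_class B" for a B
  proof -
    have inj: "inj_on a {1..n}" using a by (simp add: distinct_points_iff)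
    have "(a ` {1..n}, B) \<in> poly_equiv"
      using eq_equiv_class[OF _ equiv_poly_equiv] eq unfolding poly_class_def by blast
    then have le: "a ` {1..n} \<le>\<^sub>p B" by (simp add: poly_equiv_def)
    have card: "card (a ` {1..n}) = n" using inj by (simp add: card_image)
    obtain u v where u: "u \<noteq> 0" and "B = (\<lambda>x. u * x + v) ` (a ` {1..n})"
      by (rule poly_le_card_eq_imp_affine[OF le]) (use sub[OF B] card n in \<open>auto simp: n_subsets_def\<close>)
    define b where "b j = u * a j + v" for j
    have b: "inj_on b {1..n}" by (rule inj_onI) (simp add: b_def u inj_on_eq_iff[OF inj])
    have "B = b ` {1..n}" using \<open>B = _\<close> by (auto simp: b_def image_image)
    then obtain \<rho> where \<rho>: "\<rho> permutes {1..n}" "R \<rho>" "affinely_related {1..n} b (b \<circ> \<rho>)"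
      using B sym[OF b] by blast
    have "affinely_related {1..n} a b"
      by (rule affinely_relatedI[of _ _ u _ v]) (simp add: b_def)
    moreover have "affinely_related {1..n} (b \<circ> \<rho>) (a \<circ> \<rho>)"
      by (rule affinely_relatedI[of _ _ "1 / u" _ "- v / u"]) (simp add: b_def u field_simps)
    ultimately have "affinely_related {1..n} a (a \<circ> \<rho>)"
      using \<rho>(3) affinely_related_trans by blast
    then show ?thesis using sym[OF inj] \<rho> by blast
  qed
  have "{a \<in> distinct_points n. poly_class (a ` {1..n}) \<in> {poly_class B | B. Q B}}
      = {a \<in> distinct_points n. Q (a ` {1..n})}"
    using descend by blast
  also have "\<dots> = (\<Union>\<rho>\<in>{\<rho>. \<rho> permutes {1..n} \<and> R \<rho>}.
      {a \<in> distinct_points n. affinely_related {1..n} a (a \<circ> \<rho>)})"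
    using sym by (auto simp: distinct_points_iff)
  also have "closedin (distinct_topology n) \<dots>"
  proof (rule closedin_Union)
    show "finite ((\<lambda>\<rho>. {a \<in> distinct_points n. affinely_related {1..n} a (a \<circ> \<rho>)}) `
        {\<rho>. \<rho> permutes {1..n} \<and> R \<rho>} :: (nat \<Rightarrow> 'k) set set)"
      by (rule finite_imageI, rule finite_subset[OF _ finite_permutations[of "{1..n}"]]) auto
  qed (use closedin_symmetric_points[OF n] in blast)
  finally show ?thesis
    unfolding closedin_Sigma_topology_iff Sigma_classes_def using sub by blast
qed

theorem proposition36:
  fixes n :: nat
  assumes "n \<ge> 3"
  shows "closedin (Sigma_topology n)
           (exceptional_classes n :: 'k::{alg_closed_field, field_char_0} set set set) \<and>
         closedin (Sigma_topology n)
           (even_exceptional_classes n :: 'k set set set)"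
proof
  have n: "n \<ge> 2" using assms by simp
  show "closedin (Sigma_topology n) (exceptional_classes n :: 'k set set set)"
    unfolding exceptional_classes_def
    by (rule closedin_Sigma_of_symmetries[OF n, where R = "\<lambda>\<rho>. \<rho> \<noteq> id"])
       (simp add: exceptional_set_def, rule exceptional_set_iff_symmetry[OF n])
  show "closedin (Sigma_topology n) (even_exceptional_classes n :: 'k set set set)"
    unfolding even_exceptional_classes_def
  proof (rule closedin_Sigma_of_symmetries[OF n, where R = "\<lambda>\<rho>. \<rho> \<noteq> id \<and> \<rho> \<circ> \<rho> = id"])
    fix b :: "nat \<Rightarrow> 'k" assume b: "inj_on b {1..n}"
    show "exceptional_set n (b ` {1..n}) \<and> even (Coset.order (char_group (b ` {1..n}))) \<longleftrightarrow>
      (\<exists>\<rho>. \<rho> permutes {1..n} \<and> (\<rho> \<noteq> id \<and> \<rho> \<circ> \<rho> = id) \<and> affinely_related {1..n} b (b \<circ> \<rho>))"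
      using n exceptional_set_iff_symmetry[OF n b]
        even_char_group_iff_involutive_symmetry[of "{1..n}" b] b by auto
  qed (simp add: exceptional_set_def)
qed

end
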